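(* Let $n,m\ge1$ be integers, $0<\theta\le1$, and $s\in\{0,1,\dots,n\}$. Then $$\operatorname{Bin}(s\mid n,\theta)=\sum_{k=0}^{s}\operatorname{Spillage}\Big(s-k\,\Big|\,n,k,m\cdot\frac{1-\theta}{\theta}\Big)\cdot\operatorname{Occ}(k\mid n,m,\theta).$$
   Context: Noncentral Stirling numbers of the second kind: for an integer $n\ge0$ and real $\phi$, the numbers $S(n,k,\phi)$, $0\le k\le n$, are defined by the polynomial identity $(x+\phi)^n=\sum_{k=0}^n S(n,k,\phi)(x)_k$, where $(x)_k=\prod_{i=0}^{k-1}(x-i)$; $S(n,k,\phi)=0$ for $k>n$; and $S(n,k)=S(n,k,0)$. Convention $0^0=1$. Extended occupancy distribution: for integers $m,n\ge1$, $k\ge0$ and $0<\theta\le1$, $\operatorname{Occ}(k\mid n,m,\theta)=\frac{\theta^n}{m^n}(m)_k\,S\big(n,k,m\tfrac{1-\theta}{\theta}\big)$. Spillage distribution: for integers $0\le k\le n$, $0<\phi<\infty$ and $r=0,\dots,n-k$, $\operatorname{Spillage}(r\mid n,k,\phi)=\binom{n}{k+r}\phi^{\,n-k-r}\frac{S(k+r,k)}{S(n,k,\phi)}$; for $\phi=0$, $\operatorname{Spillage}(r\mid n,k,0)=\mathbb{I}(r=n-k)$. $\operatorname{Bin}(s\mid n,\theta)=\binom ns\theta^s(1-\theta)^{n-s}$. *)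

theory Defs
  imports
    Complex_Main
    "HOL-Computational_Algebra.Polynomial"
    "HOL-Probability.Probability_Mass_Function"
begin

definition falling_fact :: "'a::comm_ring_1 \<Rightarrow> nat \<Rightarrow> 'a" where
  "falling_fact x k = (\<Prod>i<k. x - of_nat i)"

text \<open>
  The coefficients of \<open>(x + \<phi>)\<^sup>n\<close>, as a polynomial in \<open>x\<close>, with respect to the basis of falling
  factorials. Existence and uniqueness are shown in \<open>noncentral_stirling_ex1\<close> below.
\<close>

definition noncentral_stirling :: "nat \<Rightarrow> nat \<Rightarrow> real \<Rightarrow> real" where
  "noncentral_stirling n k \<phi> =
    (THE c. [:\<phi>, 1:] ^ n = (\<Sum>j\<le>n. smult (c j) (falling_fact [:0, 1:] j)) \<and> (\<forall>j>n. c j = 0)) k"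

definition Occ :: "nat \<Rightarrow> nat \<Rightarrow> nat \<Rightarrow> real \<Rightarrow> real" where
  "Occ k n m \<theta> =
    \<theta> ^ n / real m ^ n * falling_fact (real m) k
      * noncentral_stirling n k (real m * ((1 - \<theta>) / \<theta>))"

text \<open>Meaningful only for \<open>k \<le> n\<close>, \<open>r \<le> n - k\<close> and \<open>\<phi> \<ge> 0\<close>.\<close>

definition Spillage :: "nat \<Rightarrow> nat \<Rightarrow> nat \<Rightarrow> real \<Rightarrow> real" where
  "Spillage r n k \<phi> =
    (if \<phi> = 0 then of_bool (r = n - k)
     else real (n choose (k + r)) * \<phi> ^ (n - k - r)
            * (noncentral_stirling (k + r) k 0 / noncentral_stirling n k \<phi>))"

definition Bin :: "nat \<Rightarrow> nat \<Rightarrow> real \<Rightarrow> real" where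
  "Bin s n \<theta> = real (n choose s) * \<theta> ^ s * (1 - \<theta>) ^ (n - s)"

lemma Bin_eq_pmf_binomial:
  assumes "0 \<le> \<theta>" "\<theta> \<le> 1"
  shows "Bin s n \<theta> = pmf (binomial_pmf n \<theta>) s"
  using assms by (simp add: Bin_def)

lemma falling_fact_Suc: "falling_fact x (Suc k) = (x - of_nat k) * falling_fact x k"
  by (simp add: falling_fact_def mult.commute)

lemma poly_falling_fact: "poly (falling_fact p k) x = falling_fact (poly p x) k"
  by (simp add: falling_fact_def poly_prod)

lemma falling_fact_of_nat_eq_0: "j < k \<Longrightarrow> falling_fact (real j) k = 0"
  by (auto simp: falling_fact_def)

lemma falling_fact_of_nat_self: "falling_fact (real j) j \<noteq> 0"
  by (auto simp: falling_fact_def)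

lemma noncentral_stirling_exists:
  fixes \<phi> :: real
  shows "\<exists>c. [:\<phi>, 1:] ^ n = (\<Sum>j\<le>n. smult (c j) (falling_fact [:0, 1:] j)) \<and> (\<forall>j>n. c j = 0)"
proof (induction n)
  case 0
  show ?case
    by (rule exI[of _ "\<lambda>j. of_bool (j = 0)"]) (auto simp: falling_fact_def)
next
  case (Suc n)
  define F where "F j = falling_fact ([:0, 1:] :: real poly) j" for j
  from Suc obtain c where c: "[:\<phi>, 1:] ^ n = (\<Sum>j\<le>n. smult (c j) (F j))" "\<forall>j>n. c j = 0"
    unfolding F_def by blast
  define d where "d j = (real j + \<phi>) * c j + (case j of 0 \<Rightarrow> 0 | Suc i \<Rightarrow> c i)" for j
  have step: "[:\<phi>, 1:] * F j = F (Suc j) + smult (real j + \<phi>) (F j)" for j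
  proof -
    have "[:\<phi>, 1:] = ([:0, 1:] - of_nat j) + [:real j + \<phi>:]"
      by (simp add: of_nat_poly)
    then have "[:\<phi>, 1:] * F j = ([:0, 1:] - of_nat j) * F j + [:real j + \<phi>:] * F j"
      by (metis distrib_right)
    then show ?thesis
      by (simp add: F_def falling_fact_Suc)
  qed
  have "[:\<phi>, 1:] ^ Suc n = (\<Sum>j\<le>n. smult (c j) ([:\<phi>, 1:] * F j))"
    by (simp only: power_Suc c sum_distrib_left mult_smult_right)
  also have "\<dots> = (\<Sum>j\<le>n. smult (c j) (F (Suc j))) + (\<Sum>j\<le>n. smult ((real j + \<phi>) * c j) (F j))"
    unfolding step by (simp add: smult_add_right sum.distrib mult.commute)
  also have "(\<Sum>j\<le>n. smult ((real j + \<phi>) * c j) (F j))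
      = (\<Sum>j\<le>Suc n. smult ((real j + \<phi>) * c j) (F j))"
    using c(2) by simp
  also have "(\<Sum>j\<le>n. smult (c j) (F (Suc j)))
      = (\<Sum>j\<le>Suc n. smult (case j of 0 \<Rightarrow> 0 | Suc i \<Rightarrow> c i) (F j))"
    by (subst sum.atMost_Suc_shift) simp
  also have "\<dots> + (\<Sum>j\<le>Suc n. smult ((real j + \<phi>) * c j) (F j)) = (\<Sum>j\<le>Suc n. smult (d j) (F j))"
    by (simp only: d_def smult_add_left sum.distrib add.commute)
  finally have "[:\<phi>, 1:] ^ Suc n = (\<Sum>j\<le>Suc n. smult (d j) (F j))" .
  moreover have "\<forall>j>Suc n. d j = 0"
    using c(2) by (auto simp: d_def split: nat.splits)
  ultimately show ?case
    unfolding F_def by blast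
qed

lemma falling_fact_coeffs_unique:
  fixes c d :: "nat \<Rightarrow> real"
  assumes eq: "(\<Sum>j\<le>n. smult (c j) (falling_fact [:0, 1:] j))
      = (\<Sum>j\<le>n. smult (d j) (falling_fact [:0, 1:] j))"
    and "k \<le> n"
  shows "c k = d k"
  using \<open>k \<le> n\<close>
proof (induction k rule: less_induct)
  case (less k)
  have red: "(\<Sum>j\<le>n. b j * falling_fact (real k) j)
      = (\<Sum>j<k. b j * falling_fact (real k) j) + b k * falling_fact (real k) k" for b :: "nat \<Rightarrow> real"
  proof -
    have "(\<Sum>j\<le>n. b j * falling_fact (real k) j) = (\<Sum>j\<le>k. b j * falling_fact (real k) j)"
      using less.prems by (intro sum.mono_neutral_right) (auto simp: falling_fact_of_nat_eq_0)
    then show ?thesis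
      by (simp add: lessThan_Suc_atMost[symmetric])
  qed
  have "(\<Sum>j\<le>n. c j * falling_fact (real k) j) = (\<Sum>j\<le>n. d j * falling_fact (real k) j)"
    using arg_cong[OF eq, of "\<lambda>p. poly p (real k)"] by (simp add: poly_sum poly_falling_fact)
  moreover have "(\<Sum>j<k. c j * falling_fact (real k) j) = (\<Sum>j<k. d j * falling_fact (real k) j)"
    using less by (intro sum.cong) auto
  ultimately show ?case
    using falling_fact_of_nat_self[of k] by (simp add: red)
qed

lemma noncentral_stirling_ex1:
  fixes \<phi> :: real
  shows "\<exists>!c. [:\<phi>, 1:] ^ n = (\<Sum>j\<le>n. smult (c j) (falling_fact [:0, 1:] j)) \<and> (\<forall>j>n. c j = 0)"
proof (rule ex_ex1I[OF noncentral_stirling_exists])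
  fix c d :: "nat \<Rightarrow> real"
  assume c: "[:\<phi>, 1:] ^ n = (\<Sum>j\<le>n. smult (c j) (falling_fact [:0, 1:] j)) \<and> (\<forall>j>n. c j = 0)"
    and d: "[:\<phi>, 1:] ^ n = (\<Sum>j\<le>n. smult (d j) (falling_fact [:0, 1:] j)) \<and> (\<forall>j>n. d j = 0)"
  show "c = d"
  proof
    fix k
    show "c k = d k"
      using c d falling_fact_coeffs_unique[of c n d k] by (cases "k \<le> n") auto
  qed
qed

lemma
  fixes \<phi> :: real
  shows noncentral_stirling_poly:
      "[:\<phi>, 1:] ^ n = (\<Sum>k\<le>n. smult (noncentral_stirling n k \<phi>) (falling_fact [:0, 1:] k))"
    and noncentral_stirling_eq_0: "n < k \<Longrightarrow> noncentral_stirling n k \<phi> = 0"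
  using theI'[OF noncentral_stirling_ex1[of \<phi> n]] by (auto simp: noncentral_stirling_def)

lemma noncentral_stirling_power:
  fixes x \<phi> :: real
  shows "(x + \<phi>) ^ n = (\<Sum>k\<le>n. noncentral_stirling n k \<phi> * falling_fact x k)"
  using arg_cong[OF noncentral_stirling_poly[of \<phi> n], of "\<lambda>p. poly p x"]
  by (simp add: poly_sum poly_falling_fact add.commute)

end

theory Submission
  imports Defs
begin

text \<open>
  In the product of the spillage and occupancy terms the factor \<open>S(n, k, \<phi>)\<close> cancels, so the sum over
  \<open>k\<close> is a constant times \<open>\<Sum>k\<le>s. S(s, k) (m)\<^sub>k = m\<^sup>s\<close>. The cancellation needs \<open>S(n, k, \<phi>) \<noteq> 0\<close>, which
  for \<open>\<phi> > 0\<close> comes from the triangular recurrence. The degenerate case \<open>\<phi> = 0\<close>, i.e. \<open>\<theta> = 1\<close>, is separate.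
\<close>

text \<open>Split \<open>x + \<phi>\<close> as \<open>(x - j) + (j + \<phi>)\<close>: the first
  summand is exactly the next factor of the falling factorial, the second is a scalar.\<close>

lemma linear_mult_falling_fact:
  "[:\<phi>, 1:] * falling_fact [:0, 1:] j
    = falling_fact [:0, 1:] (Suc j) + smult (real j + \<phi>) (falling_fact [:0, 1:] j)"
proof -
  have "[:\<phi>, 1:] = ([:0, 1:] - of_nat j) + [:real j + \<phi>:]"
    by (simp add: of_nat_poly)
  then have "[:\<phi>, 1:] * falling_fact [:0, 1:] j
      = ([:0, 1:] - of_nat j) * falling_fact [:0, 1:] j + [:real j + \<phi>:] * falling_fact [:0, 1:] j"
    by (metis distrib_right)
  then show ?thesis
    by (simp add: falling_fact_Suc)
qed

text \<open>Multiply the expansion of \<open>(x + \<phi>) ^ n\<close> by \<open>x + \<phi>\<close>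
  and compare coefficients, which are unique in the falling factorial basis. Beyond the degree both
  sides vanish.\<close>

lemma noncentral_stirling_Suc:
  "noncentral_stirling (Suc n) k \<phi>
    = (real k + \<phi>) * noncentral_stirling n k \<phi>
      + (case k of 0 \<Rightarrow> 0 | Suc i \<Rightarrow> noncentral_stirling n i \<phi>)"
proof (cases "k \<le> Suc n")
  case True
  define S where "S j = noncentral_stirling n j \<phi>" for j
  define F :: "nat \<Rightarrow> real poly" where "F j = falling_fact [:0, 1:] j" for j
  have "(\<Sum>j\<le>Suc n. smult (noncentral_stirling (Suc n) j \<phi>) (F j))
      = [:\<phi>, 1:] * (\<Sum>j\<le>n. smult (S j) (F j))"
    by (simp only: S_def F_def noncentral_stirling_poly[symmetric] power_Suc)
  also have "\<dots> = (\<Sum>j\<le>n. smult (S j) ([:\<phi>, 1:] * F j))"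
    by (simp only: sum_distrib_left mult_smult_right)
  also have "\<dots> = (\<Sum>j\<le>n. smult ((real j + \<phi>) * S j) (F j)) + (\<Sum>j\<le>n. smult (S j) (F (Suc j)))"
    unfolding F_def linear_mult_falling_fact
    by (simp add: smult_add_right sum.distrib mult.commute)
  \<comment> \<open>The added term is zero because \<open>S (Suc n) = 0\<close>; both sums can then
    run up to \<open>Suc n\<close>.\<close>
  also have "(\<Sum>j\<le>n. smult ((real j + \<phi>) * S j) (F j))
      = (\<Sum>j\<le>Suc n. smult ((real j + \<phi>) * S j) (F j))"
    by (simp add: S_def noncentral_stirling_eq_0)
  also have "(\<Sum>j\<le>n. smult (S j) (F (Suc j)))
      = (\<Sum>j\<le>Suc n. smult (case j of 0 \<Rightarrow> 0 | Suc i \<Rightarrow> S i) (F j))"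
    by (subst sum.atMost_Suc_shift) simp
  also have "(\<Sum>j\<le>Suc n. smult ((real j + \<phi>) * S j) (F j)) + \<dots>
      = (\<Sum>j\<le>Suc n. smult ((real j + \<phi>) * S j + (case j of 0 \<Rightarrow> 0 | Suc i \<Rightarrow> S i)) (F j))"
    by (simp only: smult_add_left sum.distrib)
  finally show ?thesis
    using falling_fact_coeffs_unique[where c = "\<lambda>j. noncentral_stirling (Suc n) j \<phi>"
        and d = "\<lambda>j. (real j + \<phi>) * S j + (case j of 0 \<Rightarrow> 0 | Suc i \<Rightarrow> S i)", OF _ True]
    unfolding F_def S_def by simp
next
  case False
  then show ?thesis
    by (simp add: noncentral_stirling_eq_0 split: nat.split)
qed

lemma noncentral_stirling_nonneg:
  "0 \<le> \<phi> \<Longrightarrow> 0 \<le> noncentral_stirling n k \<phi>"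
proof (induction n arbitrary: k)
  case 0
  \<comment> \<open>At \<open>x = 0\<close> and exponent 0 the defining identity gives the value 1
    for \<open>k = 0\<close>.\<close>
  then show ?case
    using noncentral_stirling_power[of 0 \<phi> 0]
    by (cases k) (simp_all add: falling_fact_def noncentral_stirling_eq_0)
next
  case (Suc n)
  then show ?case
    by (auto simp: noncentral_stirling_Suc split: nat.split)
qed

text \<open>One term of the recurrence is always positive: \<open>\<phi> * S(n, 0, \<phi>)\<close>
  if \<open>k = 0\<close>, and \<open>S(n, i, \<phi>)\<close> if \<open>k = Suc i\<close>. In the
  latter case the other term may vanish, at \<open>k = Suc n\<close>, so only its nonnegativity is
  used.\<close>

lemma noncentral_stirling_pos:
  "0 < \<phi> \<Longrightarrow> k \<le> n \<Longrightarrow> 0 < noncentral_stirling n k \<phi>"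
proof (induction n arbitrary: k)
  case 0
  then show ?case
    using noncentral_stirling_power[of 0 \<phi> 0] by (simp add: falling_fact_def)
next
  case (Suc n)
  show ?case
  proof (cases k)
    case 0
    then show ?thesis
      using Suc by (simp add: noncentral_stirling_Suc)
  next
    case (Suc i)
    then show ?thesis
      using Suc.IH[of i] Suc.prems noncentral_stirling_nonneg[of \<phi> n k]
      by (simp add: noncentral_stirling_Suc add_nonneg_pos)
  qed
qed

theorem theorem15:
  fixes n m s :: nat and \<theta> :: real
  assumes "n \<ge> 1" and "m \<ge> 1" and "0 < \<theta>" and "\<theta> \<le> 1" and "s \<le> n"
  shows "Bin s n \<theta>
    = (\<Sum>k=0..s. Spillage (s - k) n k (real m * ((1 - \<theta>) / \<theta>)) * Occ k n m \<theta>)"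
proof (cases "\<theta> = 1")
  case True
  \<comment> \<open>For \<open>k \<le> s \<le> n\<close> the indicator of
    \<open>s - k = n - k\<close> is that of \<open>s = n\<close>, independent of
    \<open>k\<close>.\<close>
  have "(\<Sum>k=0..s. Spillage (s - k) n k 0 * Occ k n m 1)
      = of_bool (s = n) * (\<Sum>k\<le>s. Occ k n m 1)"
    unfolding sum_distrib_left atLeast0AtMost
    using \<open>s \<le> n\<close> by (intro sum.cong) (auto simp: Spillage_def)
  also have "\<dots> = of_bool (s = n)
      * ((\<Sum>k\<le>n. noncentral_stirling n k 0 * falling_fact (real m) k) / real m ^ n)"
    by (simp add: Occ_def sum_divide_distrib mult.commute)
  \<comment> \<open>If \<open>s = n\<close>, the sum is \<open>m ^ n\<close> and both sides are 1;
    if \<open>s < n\<close>, both are 0.\<close>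
  also have "\<dots> = Bin s n 1"
    using assms noncentral_stirling_power[of "real m" 0 n, symmetric] by (auto simp: Bin_def)
  finally show ?thesis
    using True by simp
next
  case False
  define \<phi> where "\<phi> = real m * ((1 - \<theta>) / \<theta>)"
  have "\<phi> > 0"
    using assms False by (simp add: \<phi>_def)
  \<comment> \<open>Since \<open>k + (s - k) = s\<close>, the binomial coefficient and the power of
    \<open>\<phi>\<close> depend on \<open>s\<close> only; \<open>C\<close> collects everything free
    of \<open>k\<close>.\<close>
  define C where "C = real (n choose s) * \<phi> ^ (n - s) * (\<theta> ^ n / real m ^ n)"
  have Occ_eq: "Occ k n m \<theta>
      = \<theta> ^ n / real m ^ n * falling_fact (real m) k * noncentral_stirling n k \<phi>" for k
    by (simp only: Occ_def \<phi>_def)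
  have "Spillage (s - k) n k \<phi> * Occ k n m \<theta>
      = C * (noncentral_stirling s k 0 * falling_fact (real m) k)" if "k \<le> s" for k
    using that \<open>\<phi> > 0\<close> \<open>s \<le> n\<close> noncentral_stirling_pos[of \<phi> k n]
    by (simp add: Spillage_def Occ_eq C_def)
  then have "(\<Sum>k=0..s. Spillage (s - k) n k \<phi> * Occ k n m \<theta>)
      = C * (\<Sum>k\<le>s. noncentral_stirling s k 0 * falling_fact (real m) k)"
    by (simp add: sum_distrib_left atLeast0AtMost)
  also have "\<dots> = C * real m ^ s"
    using noncentral_stirling_power[of "real m" 0 s] by simp
  also have "\<dots> = Bin s n \<theta>"
  proof -
    \<comment> \<open>With \<open>r = n - s\<close>, the powers of \<open>m\<close> cancel and
      \<open>\<phi> ^ r * \<theta> ^ n\<close> leaves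
      \<open>\<theta> ^ s * (1 - \<theta>) ^ r\<close>.\<close>
    obtain r where "n = s + r"
      using \<open>s \<le> n\<close> le_Suc_ex by blast
    then show ?thesis
      using assms
      by (simp add: C_def \<phi>_def Bin_def power_add power_mult_distrib power_divide)
  qed
  finally show ?thesis
    by (simp add: \<phi>_def)
qed

end
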